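(* Let $(X,\tau_1,\tau_2)$ be a bitopological space and $i,j\in\{1,2\}$, $i\ne j$. (1) If $(X,\tau_j)$ is $T_1$, then $(X,\tau_1,\tau_2)$ is an $(i,j)$-$I$-space if and only if for each subset $A\subseteq X$ the set $A_j^d$ is $i$-discrete, i.e. $A_j^d=(A_j^d)_i^i$. (2) If $(X,\tau_1,\tau_2)$ is $(i,j)$-nodec and the set $X_j^i$ is $\tau_i$-dense in $X$, then $(X,\tau_1,\tau_2)$ is an $(i,j)$-$I$-space.
   Context: A bitopological space is a set with two topologies. For $A\subset X$ and $k\in\{1,2\}$, $A_k^d$ denotes the set of all $\tau_k$-accumulation points of $A$ in $X$, and $A_k^i=A\setminus A_k^d$ is the set of $\tau_k$-isolated points of $A$ (here the upper letters $d$ and $i$ are fixed symbols for "derived" and "isolated", not indices). $A$ is $k$-discrete if $A=A_k^i$. $(X,\tau_1,\tau_2)$ is an $(i,j)$-$I$-space if $X_j^d$ is $\tau_j$-closed and $i$-discrete. $(X,\tau_1,\tau_2)$ is $(i,j)$-nodec if every $A\subset X$ with $\tau_i\mathrm{int}\,\tau_j\mathrm{cl}\,A=\varnothing$ is $\tau_j$-closed and $i$-discrete. *)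

theory Defs
  imports "HOL-Analysis.Analysis"
begin

(* A bitopological space (X, tau_1, tau_2) is encoded by a carrier X and an indexed family
   tau; only the indices 1 and 2 carry meaning. The carrier may be empty. *)
definition bitopological_space :: "'a set \<Rightarrow> (nat \<Rightarrow> 'a topology) \<Rightarrow> bool" where
  "bitopological_space X \<tau> \<longleftrightarrow> topspace (\<tau> 1) = X \<and> topspace (\<tau> 2) = X"

definition isolated_points_of :: "'a topology \<Rightarrow> 'a set \<Rightarrow> 'a set" where
  "isolated_points_of T A = A - T derived_set_of A"

definition discrete_in :: "'a topology \<Rightarrow> 'a set \<Rightarrow> bool" where
  "discrete_in T A \<longleftrightarrow> A = isolated_points_of T A"

definition I_space :: "'a set \<Rightarrow> (nat \<Rightarrow> 'a topology) \<Rightarrow> nat \<Rightarrow> nat \<Rightarrow> bool" where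
  "I_space X \<tau> i j \<longleftrightarrow>
     closedin (\<tau> j) (\<tau> j derived_set_of X) \<and> discrete_in (\<tau> i) (\<tau> j derived_set_of X)"

definition nodec_space :: "'a set \<Rightarrow> (nat \<Rightarrow> 'a topology) \<Rightarrow> nat \<Rightarrow> nat \<Rightarrow> bool" where
  "nodec_space X \<tau> i j \<longleftrightarrow>
     (\<forall>A. A \<subseteq> X \<and> \<tau> i interior_of (\<tau> j closure_of A) = {}
        \<longrightarrow> closedin (\<tau> j) A \<and> discrete_in (\<tau> i) A)"

end

theory Submission
  imports Defs
begin

text \<open>The complement of the derived set of the whole space consists of isolated points, each
  an open singleton, so this derived set is closed
  (\<open>closedin_derived_set_of_topspace\<close>). Being an I-space thus reduces to i-discreteness
  of the j-derived set D of X. Since derived sets are monotone and discreteness is hereditary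
  (\<open>discrete_in_subset\<close>), this gives (1). For (2), density of the complement of D
  leaves D without i-interior, and D is its own j-closure, so the nodec condition applies to D
  itself.\<close>

lemma discrete_in_iff: "discrete_in T A \<longleftrightarrow> A \<inter> T derived_set_of A = {}"
  unfolding discrete_in_def isolated_points_of_def by blast

text \<open>Shrinking a set also shrinks its derived set, so the two stay disjoint.\<close>

lemma discrete_in_subset: "discrete_in T B \<Longrightarrow> A \<subseteq> B \<Longrightarrow> discrete_in T A"
  unfolding discrete_in_iff using derived_set_of_mono by blast

text \<open>A point outside the derived set of the whole space is an open singleton.\<close>

lemma closedin_derived_set_of_topspace: "closedin T (T derived_set_of topspace T)"
proof -
  have "openin T (topspace T - T derived_set_of topspace T)"
  proof (subst openin_subopen, intro ballI)
    fix x assume x: "x \<in> topspace T - T derived_set_of topspace T"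
    then obtain U where U: "x \<in> U" "openin T U" "\<And>y. y \<in> U \<Longrightarrow> y \<in> topspace T \<Longrightarrow> y = x"
      by (auto simp: in_derived_set_of)
    \<comment> \<open>An open set lies inside the carrier, so U has no point other than x.\<close>
    then have "U = {x}" using openin_subset by blast
    then show "\<exists>U. openin T U \<and> x \<in> U \<and> U \<subseteq> topspace T - T derived_set_of topspace T"
      using U x by blast
  qed
  then show ?thesis
    by (simp add: closedin_def derived_set_of_subset_topspace)
qed

text \<open>The interior is the complement of the closure of the complement.\<close>

lemma interior_of_eq_empty_if_dense_complement:
  assumes "T closure_of (topspace T - A) = topspace T"
  shows "T interior_of A = {}"
  using assms interior_of_closure_of[of T A] by simp

theorem proposition3p20:
  fixes X :: "'a set" and \<tau> :: "nat \<Rightarrow> 'a topology" and i j :: nat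
  assumes "bitopological_space X \<tau>"
    and "i \<in> {1, 2}" and "j \<in> {1, 2}" and "i \<noteq> j"
  shows "(t1_space (\<tau> j) \<longrightarrow>
            (I_space X \<tau> i j \<longleftrightarrow> (\<forall>A\<subseteq>X. discrete_in (\<tau> i) (\<tau> j derived_set_of A))))
       \<and> (nodec_space X \<tau> i j \<and> \<tau> i closure_of (isolated_points_of (\<tau> j) X) = X
            \<longrightarrow> I_space X \<tau> i j)"
proof -
  have X: "topspace (\<tau> i) = X" "topspace (\<tau> j) = X"
    using assms(1-3) unfolding bitopological_space_def by auto
  let ?D = "\<tau> j derived_set_of X"
  have closed: "closedin (\<tau> j) ?D"
    using closedin_derived_set_of_topspace[of "\<tau> j"] X by simp
  \<comment> \<open>Forwards, each derived set lies inside \<open>?D\<close>; backwards, take A =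
    X.\<close>
  have "I_space X \<tau> i j \<longleftrightarrow> (\<forall>A\<subseteq>X. discrete_in (\<tau> i) (\<tau> j derived_set_of A))"
    using closed discrete_in_subset derived_set_of_mono unfolding I_space_def by blast
  moreover have "I_space X \<tau> i j"
    if nodec: "nodec_space X \<tau> i j" and dense: "\<tau> i closure_of (isolated_points_of (\<tau> j) X) = X"
  proof -
    \<comment> \<open>The j-isolated points of X are exactly the complement of \<open>?D\<close>,
      and they are dense for the other topology.\<close>
    have "\<tau> i interior_of ?D = {}"
      using dense X interior_of_eq_empty_if_dense_complement[of "\<tau> i" ?D]
      unfolding isolated_points_of_def by simp
    then have "\<tau> i interior_of (\<tau> j closure_of ?D) = {}"
      using closed by (simp add: closure_of_closedin)
    then show ?thesis
      using nodec closedin_subset[OF closed] X unfolding nodec_space_def I_space_def by blast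
  qed
  ultimately show ?thesis by blast
qed

end
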